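(* Assume that $\mu(\mathcal M,W)<\infty$, and that there are constants $0<c\le C<\infty$ with $$c\,\mathrm{dist}(v,\mathcal M)\le\mathcal S(v,\mathcal P)\le C\,\mathrm{dist}(v,\mathcal M)\qquad\text{for all }v\in U.$$ Assume moreover that one of the following holds: (i) $\widetilde{\mathcal P}\subset\mathcal P$ is a finite (possibly very large) set of parameters, $\#\widetilde{\mathcal P}<\infty$, and $\Theta$ is a $(\epsilon,(\#\widetilde{\mathcal P})^{-1}\delta,1)$ oblivious $U\to\ell_2$ subspace embedding; or (ii) $B(\xi)$ is linear for all $\xi\in\mathcal P$, $B(\xi)=B^{(0)}+\sum_{q=1}^{m_B}\theta^B_q(\xi)B^{(q)}$ and $f(\xi)=f^{(0)}+\sum_{q=1}^{m_f}\theta^f_q(\xi)f^{(q)}$ for all $\xi\in\mathcal P$, with $\theta^B_q,\theta^f_q:\mathcal P\to\mathbb R$ and parameter-independent $B^{(q)}:U\to U'$, $f^{(q)}\in U'$, and $\Theta$ is a $(\epsilon,\delta,m_B+m_f+1)$ oblivious $U\to\ell_2$ subspace embedding. Then for any $u\in\mathcal M$, with $w=P_Wu$, with probability at least $1-N\delta$, $$\|u-A^{\mathrm{mult}}_{\mathcal S^{\Theta}}(w)\|_U\ \le\ \delta_0+2\,\kappa^{\Theta}\,\mu(\mathcal M,W)\,\min_{1\le k\le N}\|u-A_k(w)\|_U,$$ where $\kappa^{\Theta}:=\kappa\,\sqrt{1+\epsilon}/\sqrt{1-\epsilon}$ and $\kappa:=C/c$.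
   Context: **Space.** $U$ is a real Hilbert space of finite dimension $\mathcal N$. Both $U$ and its dual $U'$ are identified with $\mathbb R^{\mathcal N}$, with inner products $\langle x,y\rangle_U=x^{T}\mathbf R_U y$ and $\langle x,y\rangle_{U'}=x^{T}\mathbf R_U^{-1}y$, where $\mathbf R_U\in\mathbb R^{\mathcal N\times\mathcal N}$ is symmetric positive definite (the matrix of the Riesz map). $W\subset U$ is a subspace of dimension $m$ (observation space), $W^\perp$ its orthogonal complement and $P_W$ the orthogonal projection onto $W$ in $U$. **Equation and manifold.** $\mathcal P$ is a (nonempty, possibly infinite) parameter set. For each $\xi\in\mathcal P$ there are an operator $B(\xi):U\to U'$ and $f(\xi)\in U'$, and $u(\xi)\in U$ is the solution of $B(\xi)u(\xi)=f(\xi)$. The solution manifold is $\mathcal M=\{u(\xi):\xi\in\mathcal P\}$. Set $\mathrm{dist}(v,\mathcal M)=\inf_{z\in\mathcal M}\|v-z\|_U$ and $r(v,\xi):=B(\xi)v-f(\xi)$. **Sketching.** $\Theta$ is a linear map $U\to\mathbb R^k$ given by a random matrix $\mathbf\Theta\in\mathbb R^{k\times\mathcal N}$. It defines $\|v\|_U^{\Theta}:=\|\mathbf\Theta v\|_2$ for $v\in U$ and $\|r\|_{U'}^{\Theta}:=\|\mathbf\Theta\mathbf R_U^{-1}r\|_2$ for $r\in U'$. For $\epsilon\in[0,1)$, $\Theta$ is a $U\to\ell_2$ $\epsilon$-subspace embedding for a subspace $Y\subset U$ if $\big|\|v\|_U^2-(\|v\|_U^{\Theta})^2\big|\le\epsilon\|v\|_U^2$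 for all $v\in Y$. $\Theta$ is a $(\epsilon,\delta,d)$ oblivious $U\to\ell_2$ subspace embedding if for every (fixed) $d$-dimensional subspace $Y\subset U$, $\mathbb P(\Theta\text{ is a }U\to\ell_2\ \epsilon\text{-subspace embedding for }Y)\ge1-\delta$. The value of $d$ used is understood to be at most $\mathcal N$. **Residual-based distances.** $\mathcal S(v,\mathcal P):=\min_{\xi\in\mathcal P}\|r(v,\xi)\|_{U'}$ and $\mathcal S^{\Theta}(v,\mathcal P):=\min_{\xi\in\mathcal P}\|r(v,\xi)\|_{U'}^{\Theta}$ (minima understood as infima if not attained). **One-space recovery.** For a subspace $V\subset U$ with $V\cap W^\perp=\{0\}$ and $w\in W$, $A_V(w):=v^*+\eta^*$ with $v^*:=\arg\min_{v\in V}\|w-P_Wv\|_U$ and $\eta^*:=w-P_Wv^*$. **Multi-space recovery.** $\{V_1,\dots,V_N\}$ is a given (deterministic) library of subspaces of $U$ of dimension at most $n\le m$, each with $V_k\cap W^\perp=\{0\}$, and $A_k:=A_{V_k}$. The recovery selected by $\mathcal S^\Theta$ is $A^{\mathrm{mult}}_{\mathcal S^{\Theta}}(w):=A_{k^*}(w)$ with $k^*\in\arg\min_{1\le k\le N}\mathcal S^{\Theta}(A_k(w),\mathcal P)$. **Stability constant.** For $\sigma\ge0$, $\mathcal M_\sigma:=\{v\in U:\mathrm{dist}(v,\mathcal M)\le\sigma\}$, $U_w:=w+W^\perp$, $\delta_\sigma:=\max_{w\in W}\mathrm{diam}(\mathcal M_\sigma\cap U_w)$ (a supremum if not attained), and $\mu(\mathcal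 M,W):=\frac12\sup_{\sigma>0}\frac{\delta_\sigma-\delta_0}{\sigma}$. (The number $\delta_0$ is distinct from the failure probability parameter $\delta$.)
   Formalization: In case (i), the residual distances S and S^Θ, in the equivalence with dist(·,M) and in the selection of k*, are taken over the finite set P~ instead of P; with P infinite and only P~ controlled by the sketch, the claim fails. M, δ_0 and μ remain those of P. *)

theory Defs
  imports "HOL-Probability.Probability"
begin

text \<open>
  The space \<open>U\<close> and its dual \<open>U'\<close> are both \<open>real ^ 'n\<close>; the geometry of \<open>U\<close> is given by the
  matrix \<open>R\<close> of the Riesz map, not by the Euclidean inner product of the type.
\<close>

definition sym_pos_def :: "real ^ 'n ^ 'n \<Rightarrow> bool" where
  "sym_pos_def R \<longleftrightarrow> transpose R = R \<and> (\<forall>x. x \<noteq> 0 \<longrightarrow> 0 < x \<bullet> (R *v x))"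

definition innerU :: "real ^ 'n ^ 'n \<Rightarrow> real ^ 'n \<Rightarrow> real ^ 'n \<Rightarrow> real" where
  "innerU R x y = x \<bullet> (R *v y)"

definition normU :: "real ^ 'n ^ 'n \<Rightarrow> real ^ 'n \<Rightarrow> real" where
  "normU R x = sqrt (innerU R x x)"

definition inner_dual :: "real ^ 'n ^ 'n \<Rightarrow> real ^ 'n \<Rightarrow> real ^ 'n \<Rightarrow> real" where
  "inner_dual R x y = x \<bullet> (matrix_inv R *v y)"

definition norm_dual :: "real ^ 'n ^ 'n \<Rightarrow> real ^ 'n \<Rightarrow> real" where
  "norm_dual R x = sqrt (inner_dual R x x)"

definition distU :: "real ^ 'n ^ 'n \<Rightarrow> real ^ 'n \<Rightarrow> (real ^ 'n) set \<Rightarrow> real" where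
  "distU R v M = (INF z\<in>M. normU R (v - z))"

definition diamU :: "real ^ 'n ^ 'n \<Rightarrow> (real ^ 'n) set \<Rightarrow> ennreal" where
  "diamU R S = (SUP x\<in>S. SUP y\<in>S. ennreal (normU R (x - y)))"

definition orth_compl :: "real ^ 'n ^ 'n \<Rightarrow> (real ^ 'n) set \<Rightarrow> (real ^ 'n) set" where
  "orth_compl R W = {x. \<forall>y\<in>W. innerU R x y = 0}"

definition projU :: "real ^ 'n ^ 'n \<Rightarrow> (real ^ 'n) set \<Rightarrow> real ^ 'n \<Rightarrow> real ^ 'n" where
  "projU R W x = (THE p. p \<in> W \<and> x - p \<in> orth_compl R W)"


definition manifold :: "('p \<Rightarrow> real ^ 'n) \<Rightarrow> 'p set \<Rightarrow> (real ^ 'n) set" where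
  "manifold usol P = usol ` P"

definition residual ::
    "('p \<Rightarrow> real ^ 'n \<Rightarrow> real ^ 'n) \<Rightarrow> ('p \<Rightarrow> real ^ 'n) \<Rightarrow> real ^ 'n \<Rightarrow> 'p \<Rightarrow> real ^ 'n" where
  "residual B f v \<xi> = B \<xi> v - f \<xi>"

text \<open>
  Only the operators \<open>B \<xi>\<close> are required to be linear, not the individual terms of the expansion.
\<close>

definition affine_parametrization ::
    "'p set \<Rightarrow> ('p \<Rightarrow> real ^ 'n \<Rightarrow> real ^ 'n) \<Rightarrow> ('p \<Rightarrow> real ^ 'n) \<Rightarrow> nat \<Rightarrow> nat \<Rightarrow> bool" where
  "affine_parametrization P B f mB mf \<longleftrightarrow>
     (\<forall>\<xi>\<in>P. linear (B \<xi>)) \<and>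
     (\<exists>(\<theta>B :: nat \<Rightarrow> 'p \<Rightarrow> real) (Bq :: nat \<Rightarrow> real ^ 'n \<Rightarrow> real ^ 'n).
        \<forall>\<xi>\<in>P. \<forall>v. B \<xi> v = Bq 0 v + (\<Sum>q=1..mB. \<theta>B q \<xi> *\<^sub>R Bq q v)) \<and>
     (\<exists>(\<theta>f :: nat \<Rightarrow> 'p \<Rightarrow> real) (fq :: nat \<Rightarrow> real ^ 'n).
        \<forall>\<xi>\<in>P. f \<xi> = fq 0 + (\<Sum>q=1..mf. \<theta>f q \<xi> *\<^sub>R fq q))"


definition sketch_norm :: "real ^ 'n ^ 'k \<Rightarrow> real ^ 'n \<Rightarrow> real" where
  "sketch_norm T v = norm (T *v v)"

definition sketch_norm_dual :: "real ^ 'n ^ 'n \<Rightarrow> real ^ 'n ^ 'k \<Rightarrow> real ^ 'n \<Rightarrow> real" where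
  "sketch_norm_dual R T r = norm (T *v (matrix_inv R *v r))"

definition subspace_embedding ::
    "real ^ 'n ^ 'n \<Rightarrow> real ^ 'n ^ 'k \<Rightarrow> real \<Rightarrow> (real ^ 'n) set \<Rightarrow> bool" where
  "subspace_embedding R T \<epsilon> Y \<longleftrightarrow>
     (\<forall>v\<in>Y. \<bar>(normU R v)\<^sup>2 - (sketch_norm T v)\<^sup>2\<bar> \<le> \<epsilon> * (normU R v)\<^sup>2)"

text \<open>
  Without the bound on \<open>d\<close> there would be no \<open>d\<close>-dimensional subspace and the condition would
  be vacuous.
\<close>

definition oblivious_embedding ::
    "'w measure \<Rightarrow> real ^ 'n ^ 'n \<Rightarrow> ('w \<Rightarrow> real ^ 'n ^ 'k) \<Rightarrow> real \<Rightarrow> real \<Rightarrow> nat \<Rightarrow> bool" where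
  "oblivious_embedding \<Omega> R \<Theta> \<epsilon> \<delta> d \<longleftrightarrow>
     d \<le> CARD('n) \<and>
     (\<forall>Y. subspace Y \<and> dim Y = d \<longrightarrow>
        measure \<Omega> {\<omega> \<in> space \<Omega>. subspace_embedding R (\<Theta> \<omega>) \<epsilon> Y} \<ge> 1 - \<delta>)"


definition res_dist ::
    "real ^ 'n ^ 'n \<Rightarrow> ('p \<Rightarrow> real ^ 'n \<Rightarrow> real ^ 'n) \<Rightarrow> ('p \<Rightarrow> real ^ 'n) \<Rightarrow> real ^ 'n \<Rightarrow> 'p set \<Rightarrow> real"
  where
  "res_dist R B f v P = (INF \<xi>\<in>P. norm_dual R (residual B f v \<xi>))"

definition sketch_res_dist ::
    "real ^ 'n ^ 'n \<Rightarrow> real ^ 'n ^ 'k \<Rightarrow> ('p \<Rightarrow> real ^ 'n \<Rightarrow> real ^ 'n) \<Rightarrow> ('p \<Rightarrow> real ^ 'n)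
      \<Rightarrow> real ^ 'n \<Rightarrow> 'p set \<Rightarrow> real"
  where
  "sketch_res_dist R T B f v P = (INF \<xi>\<in>P. sketch_norm_dual R T (residual B f v \<xi>))"


text \<open>The minimizer is unique if \<open>V\<close> meets the orthogonal complement of \<open>W\<close> only in 0.\<close>

definition recovery ::
    "real ^ 'n ^ 'n \<Rightarrow> (real ^ 'n) set \<Rightarrow> (real ^ 'n) set \<Rightarrow> real ^ 'n \<Rightarrow> real ^ 'n" where
  "recovery R W V w =
     (let v = arg_min_on (\<lambda>v. normU R (w - projU R W v)) V
      in v + (w - projU R W v))"

text \<open>
  The index minimizing the sketched distance need not be unique, so the multi-space recovery is
  rendered as the set of all vectors that some choice of a minimizing index yields.
\<close>

definition multi_recovery ::
    "real ^ 'n ^ 'n \<Rightarrow> (real ^ 'n) set \<Rightarrow> (nat \<Rightarrow> (real ^ 'n) set) \<Rightarrow> nat \<Rightarrow> (real ^ 'n \<Rightarrow> real)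
      \<Rightarrow> real ^ 'n \<Rightarrow> (real ^ 'n) set"
  where
  "multi_recovery R W V N S w =
     {recovery R W (V k) w | k. is_arg_min (\<lambda>j. S (recovery R W (V j) w)) (\<lambda>j. j \<in> {1..N}) k}"


definition thickening :: "real ^ 'n ^ 'n \<Rightarrow> (real ^ 'n) set \<Rightarrow> real \<Rightarrow> (real ^ 'n) set" where
  "thickening R M \<sigma> = {v. distU R v M \<le> \<sigma>}"

definition observation_fiber ::
    "real ^ 'n ^ 'n \<Rightarrow> (real ^ 'n) set \<Rightarrow> real ^ 'n \<Rightarrow> (real ^ 'n) set" where
  "observation_fiber R W w = (\<lambda>x. w + x) ` orth_compl R W"

text \<open>
  Both constants below may be infinite. Since \<open>top - top = top\<close> in \<^typ>\<open>ennreal\<close>, the stability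
  constant is infinite whenever \<open>stab_delta R M W 0\<close> is.
\<close>

definition stab_delta ::
    "real ^ 'n ^ 'n \<Rightarrow> (real ^ 'n) set \<Rightarrow> (real ^ 'n) set \<Rightarrow> real \<Rightarrow> ennreal" where
  "stab_delta R M W \<sigma> = (SUP w\<in>W. diamU R (thickening R M \<sigma> \<inter> observation_fiber R W w))"

definition stab_mu :: "real ^ 'n ^ 'n \<Rightarrow> (real ^ 'n) set \<Rightarrow> (real ^ 'n) set \<Rightarrow> ennreal" where
  "stab_mu R M W =
     (1 / 2) * (SUP \<sigma>\<in>{0<..}. (stab_delta R M W \<sigma> - stab_delta R M W 0) / ennreal \<sigma>)"

end

theory Submission
  imports Defs
begin

text \<open>
  Every candidate \<open>a\<^sub>k\<close> produced by a one-space recovery lies in the same fiber \<open>w + W\<^sup>\<bottom>\<close> as the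
  unknown \<open>u\<close>, whatever the minimizer chosen inside it. Hence \<open>\<parallel>u - a\<parallel>\<close> is bounded by the diameter
  of a slice of the thickened manifold as soon as the selected candidate \<open>a\<close> is close to the
  manifold, and \<open>\<mu>\<close> turns the thickness into a bound affine in the thickness
  (\<open>norm_diff_le_stability\<close>).

  Closeness comes from a chain of comparisons. The residual distance is equivalent to the true
  distance with constants \<open>c\<close> and \<open>C\<close>, and the sketched residual distance is equivalent to the
  exact one with constants \<open>sqrt (1 - \<epsilon>)\<close> and \<open>sqrt (1 + \<epsilon>)\<close>, provided that \<open>\<Theta>\<close> almost preserves
  the norms of the residuals at the two candidates that are compared. As \<open>a\<close> minimizes the
  sketched distance, its distance to the manifold is at most \<open>\<kappa>\<Theta>\<close> times that of any other
  candidate (\<open>distU_le_of_sketch_le\<close>), which in turn is at most \<open>\<kappa>\<Theta> * \<parallel>u - a\<^sub>k\<parallel>\<close>.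

  The candidates do not depend on the random sketch, so obliviousness applies to each of them.
  At a fixed point \<open>v\<close> all residuals have their Riesz representatives either in finitely many
  lines, one for each parameter, or in a single subspace of dimension at most \<open>mB + mf + 1\<close>; both ways
  the sketch preserves their norms with probability at least \<open>1 - \<delta>\<close>. A union bound over the
  \<open>N\<close> candidates costs the factor \<open>N\<close>.

  Finally, the event in question has to be measurable although the infimum over the parameters
  may be uncountable. It is an infimum of continuous functions of the sketching matrix, hence
  upper semicontinuous and Borel.
\<close>

section \<open>Geometry of the space and of its dual\<close>

lemma normU_nonneg:
  assumes "sym_pos_def R"
  shows "0 \<le> normU R x"
proof -
  have "0 \<le> x \<bullet> (R *v x)"
    using assms by (cases "x = 0") (auto simp: sym_pos_def_def intro: less_imp_le)
  then show ?thesis by (simp add: normU_def innerU_def)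
qed

lemma normU_minus_commute: "normU R (x - y) = normU R (y - x)"
  by (simp add: normU_def innerU_def inner_diff_left inner_diff_right matrix_vector_mult_diff_distrib)

lemma normU_zero [simp]: "normU R 0 = 0"
  by (simp add: normU_def innerU_def)

lemma sym_pos_def_eq_zero:
  assumes "sym_pos_def R" "x \<bullet> (R *v x) = 0"
  shows "x = 0"
  using assms unfolding sym_pos_def_def by force

lemma sym_pos_def_inj:
  assumes "sym_pos_def R"
  shows "inj ((*v) R)"
proof (rule injI)
  fix x y assume "R *v x = R *v y"
  then have "(x - y) \<bullet> (R *v (x - y)) = 0"
    by (simp add: matrix_vector_mult_diff_distrib)
  then show "x = y"
    using sym_pos_def_eq_zero[OF assms, of "x - y"] by simp
qed

text \<open>The inverse Riesz map is an isometry from the dual onto the space. All statements on residuals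
  are therefore statements on their Riesz representatives.\<close>

lemma norm_dual_eq_normU_riesz:
  assumes "sym_pos_def R"
  shows "norm_dual R r = normU R (matrix_inv R *v r)"
proof -
  have "invertible R"
    using sym_pos_def_inj[OF assms] by (simp add: invertible_left_inverse matrix_left_invertible_injective)
  then have "R ** matrix_inv R = mat 1"
    unfolding invertible_def matrix_inv_def by (rule someI2_ex) simp
  then have "R *v (matrix_inv R *v r) = r"
    by (simp add: matrix_vector_mul_assoc)
  then show ?thesis
    by (simp add: norm_dual_def inner_dual_def normU_def innerU_def inner_commute)
qed

lemma norm_dual_nonneg:
  assumes "sym_pos_def R"
  shows "0 \<le> norm_dual R r"
  by (simp add: norm_dual_eq_normU_riesz[OF assms] normU_nonneg[OF assms])

lemma distU_le_normU:
  assumes "sym_pos_def R" "z \<in> M"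
  shows "distU R v M \<le> normU R (v - z)"
  unfolding distU_def
  by (rule cINF_lower) (use assms normU_nonneg in \<open>auto intro!: bdd_belowI2[where m=0]\<close>)

lemma subspace_orth_compl: "subspace (orth_compl R W)"
  by (auto simp: subspace_def orth_compl_def innerU_def inner_add_left)

text \<open>The complement of \<open>W\<close> for the inner product given by \<open>R\<close> is the Euclidean complement of the
  image of \<open>W\<close> under \<open>R\<close>. It therefore has complementary dimension, and as it meets \<open>W\<close> only
  in 0, the two spaces together span everything.\<close>

lemma orth_decomposition:
  assumes R: "sym_pos_def R" and W: "subspace W"
  obtains p q where "p \<in> W" "q \<in> orth_compl R W" "x = p + q"
proof -
  have int: "W \<inter> orth_compl R W = {0}"
    using sym_pos_def_eq_zero[OF R] subspace_0[OF W] subspace_0[OF subspace_orth_compl[of R W]]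
    by (auto simp: orth_compl_def innerU_def)
  have "orth_compl R W = {y \<in> UNIV. \<forall>x\<in>(*v) R ` W. orthogonal x y}"
    by (auto simp: orth_compl_def innerU_def orthogonal_def inner_commute)
  moreover have "dim {y \<in> UNIV. \<forall>x\<in>(*v) R ` W. orthogonal x y} + dim ((*v) R ` W)
      = dim (UNIV :: (real^'a) set)"
    by (rule dim_subspace_orthogonal_to_vectors)
      (auto intro: linear_subspace_image W)
  moreover have "dim ((*v) R ` W) = dim W"
    by (rule dim_image_eq)
      (use sym_pos_def_inj[OF R] in \<open>auto intro: inj_on_subset\<close>)
  ultimately have "dim W + dim (orth_compl R W) = dim (UNIV :: (real^'a) set)"
    by simp
  with dim_sums_Int[OF W subspace_orth_compl[of R W]] int
  have "dim {x + y |x y. x \<in> W \<and> y \<in> orth_compl R W} = dim (UNIV :: (real^'a) set)"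
    by simp
  then have "span {x + y |x y. x \<in> W \<and> y \<in> orth_compl R W} = UNIV"
    by (simp only: dim_UNIV dim_eq_full)
  then have "{x + y |x y. x \<in> W \<and> y \<in> orth_compl R W} = UNIV"
    by (simp only: span_eq_iff[THEN iffD2, OF subspace_sums[OF W subspace_orth_compl]])
  then have "x \<in> {x + y |x y. x \<in> W \<and> y \<in> orth_compl R W}" by (simp only: UNIV_I)
  then show ?thesis using that by blast
qed

lemma projU_orthogonal:
  assumes R: "sym_pos_def R" and W: "subspace W"
  shows "projU R W x \<in> W" "x - projU R W x \<in> orth_compl R W"
proof -
  obtain p q where pq: "p \<in> W" "q \<in> orth_compl R W" "x = p + q"
    using orth_decomposition[OF R W] .
  have "projU R W x \<in> W \<and> x - projU R W x \<in> orth_compl R W"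
    unfolding projU_def
  proof (rule theI)
    show "p \<in> W \<and> x - p \<in> orth_compl R W" using pq by simp
  next
    fix p' assume p': "p' \<in> W \<and> x - p' \<in> orth_compl R W"
    have "(x - p) - (x - p') \<in> orth_compl R W"
      by (rule subspace_diff[OF subspace_orth_compl]) (use p' pq in simp_all)
    moreover have "p' - p \<in> W" using p' pq W by (simp add: subspace_diff)
    ultimately have "(p' - p) \<bullet> (R *v (p' - p)) = 0"
      by (simp add: orth_compl_def innerU_def)
    then show "p' = p" using sym_pos_def_eq_zero[OF R, of "p' - p"] by simp
  qed
  then show "projU R W x \<in> W" "x - projU R W x \<in> orth_compl R W" by auto
qed

text \<open>The correction \<open>w - P\<^sub>W v\<close> makes every recovery consistent with the observation, no matter
  which \<open>v\<close> is corrected.\<close>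

lemma recovery_in_observation_fiber:
  assumes "sym_pos_def R" "subspace W"
  shows "recovery R W V' w \<in> observation_fiber R W w"
proof -
  define v where "v = arg_min_on (\<lambda>v. normU R (w - projU R W v)) V'"
  have "recovery R W V' w = w + (v - projU R W v)"
    unfolding recovery_def Let_def v_def[symmetric] by (simp add: algebra_simps)
  then show ?thesis
    unfolding observation_fiber_def by (rule image_eqI) (rule projU_orthogonal(2)[OF assms])
qed

section \<open>Stability of the inverse problem\<close>

text \<open>The two points lie in one slice of the thickening, so \<open>stab_delta R M W \<sigma>\<close> bounds their
  distance, and the difference quotient at \<open>\<sigma>\<close> is at most \<open>2 * stab_mu R M W\<close>. The quotient is
  available only for \<open>\<sigma> > 0\<close>; for \<open>\<sigma> = 0\<close> the bound is the one by \<open>stab_delta R M W 0\<close> alone.\<close>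

lemma norm_diff_le_stability:
  assumes "w \<in> W" "0 \<le> \<sigma>"
    and "x \<in> thickening R M \<sigma>" "x \<in> observation_fiber R W w"
    and "y \<in> thickening R M \<sigma>" "y \<in> observation_fiber R W w"
  shows "ennreal (normU R (x - y))
    \<le> stab_delta R M W 0 + 2 * stab_mu R M W * ennreal \<sigma>"
proof -
  let ?D = "stab_delta R M W"
  have "ennreal (normU R (x - y)) \<le> diamU R (thickening R M \<sigma> \<inter> observation_fiber R W w)"
    unfolding diamU_def using assms by (intro SUP_upper2[of x] SUP_upper2[of y]) auto
  also have "\<dots> \<le> ?D \<sigma>"
    unfolding stab_delta_def using assms by (intro SUP_upper) auto
  also have "\<dots> \<le> ?D 0 + 2 * stab_mu R M W * ennreal \<sigma>"
  proof (cases "\<sigma> = 0")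
    case False
    with assms have \<sigma>: "0 < \<sigma>" by simp
    let ?S = "SUP \<sigma>\<in>{0<..}. (?D \<sigma> - ?D 0) / ennreal \<sigma>"
    have mu: "2 * stab_mu R M W = ?S"
    proof -
      have "2 * (1 / 2 :: ennreal) = 1"
        using ennreal_times_divide[of 2 1 2] by simp
      then show ?thesis by (simp add: stab_mu_def mult.assoc[symmetric])
    qed
    have "?D \<sigma> - ?D 0 = (?D \<sigma> - ?D 0) / ennreal \<sigma> * ennreal \<sigma>"
      using \<sigma> by (simp add: ennreal_divide_times)
    also have "\<dots> \<le> ?S * ennreal \<sigma>"
      using \<sigma> by (intro mult_right_mono SUP_upper) auto
    finally have "?D \<sigma> - ?D 0 \<le> ?S * ennreal \<sigma>" .
    then show ?thesis
      unfolding mu by (metis ennreal_minus_le_iff)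
  qed simp
  finally show ?thesis .
qed

section \<open>Sketched residual distances\<close>

text \<open>The set on which the sketch has to preserve norms so that the sketched residual distance at
  \<open>v\<close> is comparable with the exact one.\<close>

definition residual_reps ::
    "real ^ 'n ^ 'n \<Rightarrow> ('p \<Rightarrow> real ^ 'n \<Rightarrow> real ^ 'n) \<Rightarrow> ('p \<Rightarrow> real ^ 'n) \<Rightarrow> 'p set
      \<Rightarrow> real ^ 'n \<Rightarrow> (real ^ 'n) set"
  where "residual_reps R B f Q v = (\<lambda>\<xi>. matrix_inv R *v residual B f v \<xi>) ` Q"

lemma subspace_embedding_sketch_norm_bounds:
  assumes R: "sym_pos_def R" and "subspace_embedding R T \<epsilon> Y" "x \<in> Y" "0 \<le> \<epsilon>" "\<epsilon> < 1"
  shows "sqrt (1 - \<epsilon>) * normU R x \<le> sketch_norm T x"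
    and "sketch_norm T x \<le> sqrt (1 + \<epsilon>) * normU R x"
proof -
  have a: "\<bar>(normU R x)\<^sup>2 - (sketch_norm T x)\<^sup>2\<bar> \<le> \<epsilon> * (normU R x)\<^sup>2"
    using assms by (auto simp: subspace_embedding_def)
  have pos: "0 \<le> sketch_norm T x" "0 \<le> normU R x"
    by (simp_all add: sketch_norm_def normU_nonneg[OF R])
  show "sqrt (1 - \<epsilon>) * normU R x \<le> sketch_norm T x"
    by (rule power2_le_imp_le) (use a assms pos in \<open>auto simp: algebra_simps\<close>)
  show "sketch_norm T x \<le> sqrt (1 + \<epsilon>) * normU R x"
    by (rule power2_le_imp_le) (use a assms pos in \<open>auto simp: algebra_simps\<close>)
qed

lemma sketch_res_dist_bounds:
  assumes R: "sym_pos_def R" and emb: "subspace_embedding R T \<epsilon> (residual_reps R B f Q v)"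
    and \<epsilon>: "0 \<le> \<epsilon>" "\<epsilon> < 1" and Q: "Q \<noteq> {}"
  shows "sqrt (1 - \<epsilon>) * res_dist R B f v Q \<le> sketch_res_dist R T B f v Q"
    and "sketch_res_dist R T B f v Q \<le> sqrt (1 + \<epsilon>) * res_dist R B f v Q"
proof -
  have lo: "sqrt (1 - \<epsilon>) * norm_dual R (residual B f v \<xi>) \<le> sketch_norm_dual R T (residual B f v \<xi>)"
    and up: "sketch_norm_dual R T (residual B f v \<xi>) \<le> sqrt (1 + \<epsilon>) * norm_dual R (residual B f v \<xi>)"
    if "\<xi> \<in> Q" for \<xi>
    using subspace_embedding_sketch_norm_bounds[OF R emb _ \<epsilon>,
        of "matrix_inv R *v residual B f v \<xi>"] that
    by (auto simp: residual_reps_def sketch_norm_dual_def sketch_norm_def norm_dual_eq_normU_riesz[OF R])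
  have bdd: "bdd_below ((\<lambda>\<xi>. norm_dual R (residual B f v \<xi>)) ` Q)"
    "bdd_below ((\<lambda>\<xi>. sketch_norm_dual R T (residual B f v \<xi>)) ` Q)"
    by (auto intro!: bdd_belowI2[where m=0] simp: norm_dual_nonneg[OF R] sketch_norm_dual_def)
  show "sqrt (1 - \<epsilon>) * res_dist R B f v Q \<le> sketch_res_dist R T B f v Q"
    unfolding sketch_res_dist_def
  proof (rule cINF_greatest[OF Q])
    fix \<xi> assume \<xi>: "\<xi> \<in> Q"
    have "sqrt (1 - \<epsilon>) * res_dist R B f v Q \<le> sqrt (1 - \<epsilon>) * norm_dual R (residual B f v \<xi>)"
      unfolding res_dist_def using \<epsilon> by (intro mult_left_mono cINF_lower bdd \<xi>) auto
    with lo[OF \<xi>] show "sqrt (1 - \<epsilon>) * res_dist R B f v Q \<le> sketch_norm_dual R T (residual B f v \<xi>)"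
      by simp
  qed
  have s: "0 < sqrt (1 + \<epsilon>)" using \<epsilon> by simp
  have "sketch_res_dist R T B f v Q / sqrt (1 + \<epsilon>) \<le> res_dist R B f v Q"
    unfolding res_dist_def
  proof (rule cINF_greatest[OF Q])
    fix \<xi> assume \<xi>: "\<xi> \<in> Q"
    have "sketch_res_dist R T B f v Q \<le> sketch_norm_dual R T (residual B f v \<xi>)"
      unfolding sketch_res_dist_def by (intro cINF_lower bdd \<xi>)
    with up[OF \<xi>] s show "sketch_res_dist R T B f v Q / sqrt (1 + \<epsilon>) \<le> norm_dual R (residual B f v \<xi>)"
      by (simp add: pos_divide_le_eq mult.commute)
  qed
  with s show "sketch_res_dist R T B f v Q \<le> sqrt (1 + \<epsilon>) * res_dist R B f v Q"
    by (simp add: pos_divide_le_eq mult.commute)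
qed

text \<open>Selecting by the sketched distance instead of the true one loses the factor \<open>C / c\<close> for the
  residual surrogate and the factor \<open>sqrt (1 + \<epsilon>) / sqrt (1 - \<epsilon>)\<close> for the sketch.\<close>

lemma distU_le_of_sketch_le:
  assumes R: "sym_pos_def R" and \<epsilon>: "0 \<le> \<epsilon>" "\<epsilon> < 1" and Q: "Q \<noteq> {}" and c: "0 < c"
    and lower: "c * distU R a M \<le> res_dist R B f a Q"
    and upper: "res_dist R B f b Q \<le> C * distU R b M"
    and emb: "subspace_embedding R T \<epsilon> (residual_reps R B f Q a)"
      "subspace_embedding R T \<epsilon> (residual_reps R B f Q b)"
    and le: "sketch_res_dist R T B f a Q \<le> sketch_res_dist R T B f b Q"
  shows "distU R a M \<le> C / c * sqrt (1 + \<epsilon>) / sqrt (1 - \<epsilon>) * distU R b M"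
proof -
  have pos: "0 < sqrt (1 - \<epsilon>)" "0 < sqrt (1 + \<epsilon>)" using \<epsilon> by auto
  have "sqrt (1 - \<epsilon>) * (c * distU R a M) \<le> sqrt (1 - \<epsilon>) * res_dist R B f a Q"
    using lower pos by (intro mult_left_mono) auto
  also have "\<dots> \<le> sketch_res_dist R T B f b Q"
    using sketch_res_dist_bounds(1)[OF R emb(1) \<epsilon> Q] le by simp
  also have "\<dots> \<le> sqrt (1 + \<epsilon>) * res_dist R B f b Q"
    by (rule sketch_res_dist_bounds(2)[OF R emb(2) \<epsilon> Q])
  also have "\<dots> \<le> sqrt (1 + \<epsilon>) * (C * distU R b M)"
    using upper pos by (intro mult_left_mono) auto
  finally show ?thesis using pos c by (simp add: field_simps)
qed

section \<open>Measurability\<close>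

lemma continuous_on_matrix_vector_mult_left:
  fixes x :: "real ^ 'n"
  shows "continuous_on S (\<lambda>T :: real ^ 'n ^ 'k. T *v x)"
proof -
  have "linear (\<lambda>T :: real ^ 'n ^ 'k. T *v x)"
    by (rule linearI) (simp_all add: matrix_vector_mult_add_rdistrib scaleR_matrix_vector_assoc)
  then show ?thesis by (simp add: linear_continuous_on linear_conv_bounded_linear)
qed

lemma sets_subspace_embedding:
  fixes \<Theta> :: "'w \<Rightarrow> real ^ 'n ^ 'k"
  assumes "\<Theta> \<in> borel_measurable \<Omega>"
  shows "{\<omega> \<in> space \<Omega>. subspace_embedding R (\<Theta> \<omega>) \<epsilon> Y} \<in> sets \<Omega>"
proof -
  have "closed {T :: real ^ 'n ^ 'k. subspace_embedding R T \<epsilon> Y}"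
  proof -
    have "{T :: real ^ 'n ^ 'k. subspace_embedding R T \<epsilon> Y} =
      (\<Inter>v\<in>Y. {T. \<bar>(normU R v)\<^sup>2 - (sketch_norm T v)\<^sup>2\<bar> \<le> \<epsilon> * (normU R v)\<^sup>2})"
      by (auto simp: subspace_embedding_def)
    moreover have "closed {T :: real ^ 'n ^ 'k. \<bar>(normU R v)\<^sup>2 - (sketch_norm T v)\<^sup>2\<bar> \<le> \<epsilon> * (normU R v)\<^sup>2}" for v
      unfolding sketch_norm_def
      by (intro closed_Collect_le continuous_intros continuous_on_matrix_vector_mult_left)
    ultimately show ?thesis by (simp add: closed_INT)
  qed
  then have "\<Theta> -` {T. subspace_embedding R T \<epsilon> Y} \<inter> space \<Omega> \<in> sets \<Omega>"
    using assms by (intro measurable_sets) auto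
  then show ?thesis by (simp add: vimage_def Int_def conj_commute)
qed

text \<open>The parameter set may be uncountable, but the strict sublevel sets of an infimum of continuous
  functions are unions of open sets.\<close>

lemma borel_measurable_sketch_res_dist:
  assumes \<Theta>: "\<Theta> \<in> borel_measurable \<Omega>" and Q: "Q \<noteq> {}"
  shows "(\<lambda>\<omega>. sketch_res_dist R (\<Theta> \<omega>) B f v Q) \<in> borel_measurable \<Omega>"
proof (rule borel_measurableI_less)
  fix t
  let ?U = "\<Union>\<xi>\<in>Q. {T. sketch_norm_dual R T (residual B f v \<xi>) < t}"
  have "open ?U"
    unfolding sketch_norm_dual_def
    by (intro open_UN ballI open_Collect_less continuous_intros continuous_on_matrix_vector_mult_left)
  then have "\<Theta> -` ?U \<inter> space \<Omega> \<in> sets \<Omega>"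
    by (intro measurable_sets[OF \<Theta>] borel_open)
  moreover have "sketch_res_dist R (\<Theta> \<omega>) B f v Q < t \<longleftrightarrow> \<Theta> \<omega> \<in> ?U" for \<omega>
    unfolding sketch_res_dist_def
    by (subst cINF_less_iff[OF Q]) (auto intro!: bdd_belowI2[where m=0] simp: sketch_norm_dual_def)
  ultimately show "{\<omega> \<in> space \<Omega>. sketch_res_dist R (\<Theta> \<omega>) B f v Q < t} \<in> sets \<Omega>"
    by (simp add: vimage_def Int_def conj_commute)
qed

section \<open>Probability of preserving the residuals\<close>

lemma (in prob_space) prob_ball_ge:
  assumes "finite I" and meas: "\<And>i. i \<in> I \<Longrightarrow> {\<omega> \<in> space M. E i \<omega>} \<in> events"
    and prob: "\<And>i. i \<in> I \<Longrightarrow> prob {\<omega> \<in> space M. E i \<omega>} \<ge> 1 - p"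
  shows "prob {\<omega> \<in> space M. \<forall>i\<in>I. E i \<omega>} \<ge> 1 - real (card I) * p"
proof -
  have ev: "{\<omega> \<in> space M. \<forall>i\<in>I. E i \<omega>} \<in> events"
    using assms by (intro sets.sets_Collect_finite_All) auto
  have meas': "{\<omega> \<in> space M. \<not> E i \<omega>} \<in> events" if "i \<in> I" for i
    by (rule sets.sets_Collect_neg) (rule meas[OF that])
  have "prob {\<omega> \<in> space M. \<not> (\<forall>i\<in>I. E i \<omega>)} = prob (\<Union>i\<in>I. {\<omega> \<in> space M. \<not> E i \<omega>})"
    by (rule arg_cong[where f=prob]) auto
  also have "\<dots> \<le> (\<Sum>i\<in>I. prob {\<omega> \<in> space M. \<not> E i \<omega>})"
    using assms meas' by (intro finite_measure_subadditive_finite) auto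
  also have "\<dots> \<le> (\<Sum>i\<in>I. p)"
    using prob prob_neg[OF meas] by (intro sum_mono) fastforce
  finally show ?thesis using prob_neg[OF ev] by simp
qed

lemma subspace_superset_of_dim:
  fixes S :: "'a::euclidean_space set"
  assumes "dim S \<le> d" "d \<le> DIM('a)"
  obtains Y where "subspace Y" "S \<subseteq> Y" "dim Y = d"
proof -
  have "\<exists>Y. subspace Y \<and> S \<subseteq> Y \<and> dim Y = d"
    using assms
  proof (induction d rule: dec_induct)
    case base
    show ?case using span_superset by (intro exI[of _ "span S"]) auto
  next
    case (step e)
    then obtain Y where Y: "subspace Y" "S \<subseteq> Y" "dim Y = e" by auto
    with step.prems have "span Y \<noteq> UNIV" using dim_eq_full[of Y] by auto
    then obtain x where "x \<notin> span Y" by auto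
    then have "dim (span (insert x Y)) = Suc e" using Y by (simp add: dim_insert)
    moreover have "S \<subseteq> span (insert x Y)" using Y span_superset[of "insert x Y"] by blast
    ultimately show ?case using subspace_span by blast
  qed
  then show ?thesis using that by blast
qed

text \<open>Obliviousness speaks of subspaces of dimension exactly \<open>d\<close>. Smaller sets are enlarged to such
  a subspace, and the embedding property is inherited by subsets.\<close>

lemma oblivious_embedding_prob_of_dim_le:
  fixes R :: "real ^ 'n ^ 'n"
  assumes \<Omega>: "prob_space \<Omega>" and \<Theta>: "\<Theta> \<in> borel_measurable \<Omega>"
    and ob: "oblivious_embedding \<Omega> R \<Theta> \<epsilon> \<delta> d" and X: "dim X \<le> d"
  shows "measure \<Omega> {\<omega> \<in> space \<Omega>. subspace_embedding R (\<Theta> \<omega>) \<epsilon> X} \<ge> 1 - \<delta>"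
proof -
  interpret prob_space \<Omega> by (rule \<Omega>)
  have "d \<le> DIM(real ^ 'n)" using ob by (simp add: oblivious_embedding_def)
  then obtain Y where Y: "subspace Y" "X \<subseteq> Y" "dim Y = d"
    using subspace_superset_of_dim[OF X] by blast
  have "1 - \<delta> \<le> prob {\<omega> \<in> space \<Omega>. subspace_embedding R (\<Theta> \<omega>) \<epsilon> Y}"
    using ob Y by (auto simp: oblivious_embedding_def)
  also have "\<dots> \<le> prob {\<omega> \<in> space \<Omega>. subspace_embedding R (\<Theta> \<omega>) \<epsilon> X}"
    using Y by (intro finite_measure_mono sets_subspace_embedding[OF \<Theta>])
      (auto simp: subspace_embedding_def)
  finally show ?thesis .
qed

lemma finite_parameters_residuals_preserved:
  assumes \<Omega>: "prob_space \<Omega>" and \<Theta>: "\<Theta> \<in> borel_measurable \<Omega>" and Q: "finite Q" "Q \<noteq> {}"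
    and ob: "oblivious_embedding \<Omega> R \<Theta> \<epsilon> (\<delta> / real (card Q)) 1"
  shows "measure \<Omega> {\<omega> \<in> space \<Omega>. subspace_embedding R (\<Theta> \<omega>) \<epsilon> (residual_reps R B f Q v)} \<ge> 1 - \<delta>"
proof -
  interpret prob_space \<Omega> by (rule \<Omega>)
  let ?y = "\<lambda>\<xi>. matrix_inv R *v residual B f v \<xi>"
  have "prob {\<omega> \<in> space \<Omega>. subspace_embedding R (\<Theta> \<omega>) \<epsilon> {?y \<xi>}} \<ge> 1 - \<delta> / real (card Q)" for \<xi>
    using dim_le_card'[of "{?y \<xi>}"] by (intro oblivious_embedding_prob_of_dim_le[OF \<Omega> \<Theta> ob]) simp
  then have "prob {\<omega> \<in> space \<Omega>. \<forall>\<xi>\<in>Q. subspace_embedding R (\<Theta> \<omega>) \<epsilon> {?y \<xi>}}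
      \<ge> 1 - real (card Q) * (\<delta> / real (card Q))"
    by (intro prob_ball_ge Q sets_subspace_embedding[OF \<Theta>])
  moreover have "(\<forall>\<xi>\<in>Q. subspace_embedding R (\<Theta> \<omega>) \<epsilon> {?y \<xi>})
      \<longleftrightarrow> subspace_embedding R (\<Theta> \<omega>) \<epsilon> (residual_reps R B f Q v)" for \<omega>
    by (auto simp: residual_reps_def subspace_embedding_def)
  ultimately show ?thesis using Q by simp
qed

text \<open>At a fixed \<open>v\<close> the affine expansions of \<open>B\<close> and \<open>f\<close> write every residual as a combination of
  \<open>mB + mf + 1\<close> vectors that do not depend on the parameter, the constant terms being merged
  into one.\<close>

lemma affine_residuals_dim_le:
  assumes "affine_parametrization P B f mB mf"
  shows "dim (residual_reps R B f P v) \<le> mB + mf + 1"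
proof -
  obtain \<theta>B :: "nat \<Rightarrow> _" and Bq
    where B: "\<forall>\<xi>\<in>P. \<forall>v. B \<xi> v = Bq 0 v + (\<Sum>q=1..mB. \<theta>B q \<xi> *\<^sub>R Bq q v)"
    using assms unfolding affine_parametrization_def by blast
  obtain \<theta>f :: "nat \<Rightarrow> _" and fq
    where f: "\<forall>\<xi>\<in>P. f \<xi> = fq 0 + (\<Sum>q=1..mf. \<theta>f q \<xi> *\<^sub>R fq q)"
    using assms unfolding affine_parametrization_def by blast
  let ?A = "insert (Bq 0 v - fq 0) ((\<lambda>q. Bq q v) ` {1..mB} \<union> fq ` {1..mf})"
  have "residual B f v \<xi> \<in> span ?A" if "\<xi> \<in> P" for \<xi>
  proof -
    have "residual B f v \<xi> = (Bq 0 v - fq 0) + ((\<Sum>q=1..mB. \<theta>B q \<xi> *\<^sub>R Bq q v)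
        - (\<Sum>q=1..mf. \<theta>f q \<xi> *\<^sub>R fq q))"
      using B f that by (simp add: residual_def)
    also have "\<dots> \<in> span ?A"
    proof (rule span_add)
      show "Bq 0 v - fq 0 \<in> span ?A" by (rule span_base) simp
      show "(\<Sum>q=1..mB. \<theta>B q \<xi> *\<^sub>R Bq q v) - (\<Sum>q=1..mf. \<theta>f q \<xi> *\<^sub>R fq q) \<in> span ?A"
        by (intro span_diff span_sum span_scale span_base) auto
    qed
    finally show ?thesis .
  qed
  then have "residual_reps R B f P v \<subseteq> (*v) (matrix_inv R) ` span ?A"
    by (auto simp: residual_reps_def)
  then have "dim (residual_reps R B f P v) \<le> dim ((*v) (matrix_inv R) ` span ?A)"
    by (rule dim_subset)
  also have "\<dots> \<le> dim (span ?A)"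
    by (rule dim_image_le) simp
  also have "\<dots> \<le> card ?A" by (simp add: dim_le_card')
  also have "\<dots> \<le> Suc (card ((\<lambda>q. Bq q v) ` {1..mB} \<union> fq ` {1..mf}))"
    by (simp add: card_insert_le_m1 card_insert_if)
  also have "\<dots> \<le> mB + mf + 1"
    using card_Un_le[of "(\<lambda>q. Bq q v) ` {1..mB}" "fq ` {1..mf}"]
      card_image_le[of "{1..mB}" "\<lambda>q. Bq q v"] card_image_le[of "{1..mf}" fq] by simp
  finally show ?thesis .
qed

section \<open>Recovery with the sketched selection\<close>

theorem corollary4p3:
  fixes R :: "real ^ 'n ^ 'n"
    and W :: "(real ^ 'n) set"
    and P Q :: "'p set"
    and B :: "'p \<Rightarrow> real ^ 'n \<Rightarrow> real ^ 'n"
    and f usol :: "'p \<Rightarrow> real ^ 'n"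
    and \<Omega> :: "'w measure"
    and \<Theta> :: "'w \<Rightarrow> real ^ 'n ^ 'k"
    and V :: "nat \<Rightarrow> (real ^ 'n) set"
    and N n m :: nat
    and c C \<epsilon> \<delta> \<kappa> \<kappa>\<Theta> :: real
    and u w :: "real ^ 'n"
  assumes R: "sym_pos_def R"
    and W: "subspace W" "dim W = m"
    and P: "P \<noteq> {}"
    and usol: "\<And>\<xi> v. \<xi> \<in> P \<Longrightarrow> B \<xi> v = f \<xi> \<longleftrightarrow> v = usol \<xi>"
    and N: "1 \<le> N" and n: "n \<le> m"
    and V: "\<And>k. k \<in> {1..N} \<Longrightarrow> subspace (V k)"
           "\<And>k. k \<in> {1..N} \<Longrightarrow> dim (V k) \<le> n"
           "\<And>k. k \<in> {1..N} \<Longrightarrow> V k \<inter> orth_compl R W = {0}"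
    and \<Omega>: "prob_space \<Omega>" and \<Theta>: "\<Theta> \<in> borel_measurable \<Omega>"
    and \<epsilon>: "0 \<le> \<epsilon>" "\<epsilon> < 1"
    and mu: "stab_mu R (manifold usol P) W < \<infinity>"
    and c: "0 < c" "c \<le> C"
    and equiv: "\<And>v. c * distU R v (manifold usol P) \<le> res_dist R B f v Q"
               "\<And>v. res_dist R B f v Q \<le> C * distU R v (manifold usol P)"
    and cases:
      "(Q \<subseteq> P \<and> Q \<noteq> {} \<and> finite Q \<and> oblivious_embedding \<Omega> R \<Theta> \<epsilon> (\<delta> / real (card Q)) 1) \<or>
       (Q = P \<and> (\<exists>mB mf. affine_parametrization P B f mB mf \<and>
                          oblivious_embedding \<Omega> R \<Theta> \<epsilon> \<delta> (mB + mf + 1)))"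
    and \<kappa>: "\<kappa> = C / c" "\<kappa>\<Theta> = \<kappa> * sqrt (1 + \<epsilon>) / sqrt (1 - \<epsilon>)"
    and u: "u \<in> manifold usol P" and w: "w = projU R W u"
  shows "measure \<Omega> {\<omega> \<in> space \<Omega>.
           \<forall>a \<in> multi_recovery R W V N (\<lambda>v. sketch_res_dist R (\<Theta> \<omega>) B f v Q) w.
             ennreal (normU R (u - a))
               \<le> stab_delta R (manifold usol P) W 0
                 + ennreal (2 * \<kappa>\<Theta>) * stab_mu R (manifold usol P) W
                   * ennreal (MIN k\<in>{1..N}. normU R (u - recovery R W (V k) w))}
         \<ge> 1 - real N * \<delta>"
proof -
  interpret prob_space \<Omega> by (rule \<Omega>)
  define M where "M = manifold usol P"
  define a where "a k = recovery R W (V k) w" for k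
  define e where "e = (MIN k\<in>{1..N}. normU R (u - a k))"
  define good where "good k \<longleftrightarrow> ennreal (normU R (u - a k))
      \<le> stab_delta R M W 0 + ennreal (2 * \<kappa>\<Theta>) * stab_mu R M W * ennreal e" for k
  \<comment> \<open>The minimizing index need not be unique, so the bound is shown for every index that the
    sketched distance may select.\<close>
  define sel where "sel \<omega> k \<longleftrightarrow> (\<forall>j\<in>{1..N}. \<not> sketch_res_dist R (\<Theta> \<omega>) B f (a j) Q
      < sketch_res_dist R (\<Theta> \<omega>) B f (a k) Q)" for \<omega> k
  define E where "E k \<omega> \<longleftrightarrow> subspace_embedding R (\<Theta> \<omega>) \<epsilon> (residual_reps R B f Q (a k))" for k \<omega>

  have Q: "Q \<noteq> {}" using cases P by auto
  have \<kappa>\<Theta>_nonneg: "0 \<le> \<kappa>\<Theta>" using \<kappa> c \<epsilon> by simp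
  have wW: "w \<in> W" using projU_orthogonal(1)[OF R W(1)] w by simp
  have ufib: "u \<in> observation_fiber R W w"
    unfolding observation_fiber_def
    by (rule image_eqI[of _ _ "u - w"]) (simp_all add: w projU_orthogonal(2)[OF R W(1)])
  have e_attained: "\<exists>j\<in>{1..N}. e = normU R (u - a j)"
  proof -
    have "e \<in> (\<lambda>k. normU R (u - a k)) ` {1..N}"
      unfolding e_def using N by (intro Min_in) auto
    then show ?thesis by auto
  qed
  have e_nonneg: "0 \<le> e" using e_attained normU_nonneg[OF R] by auto

  have selected_good: "good k" if k: "k \<in> {1..N}" "sel \<omega> k" and E: "\<forall>j\<in>{1..N}. E j \<omega>" for k \<omega>
  proof -
    obtain j where j: "j \<in> {1..N}" "e = normU R (u - a j)" using e_attained by auto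
    have "distU R (a k) M \<le> C / c * sqrt (1 + \<epsilon>) / sqrt (1 - \<epsilon>) * distU R (a j) M"
      using k E j by (intro distU_le_of_sketch_le[OF R \<epsilon> Q c(1), of _ _ B f _ _ "\<Theta> \<omega>"])
        (auto simp: M_def E_def sel_def not_less intro: equiv)
    also have "\<dots> = \<kappa>\<Theta> * distU R (a j) M" by (simp only: \<kappa>)
    also have "\<dots> \<le> \<kappa>\<Theta> * e"
      using distU_le_normU[OF R u, of "a j"]
      unfolding j(2) M_def normU_minus_commute[of R u "a j"] by (rule mult_left_mono) (rule \<kappa>\<Theta>_nonneg)
    finally have "a k \<in> thickening R M (\<kappa>\<Theta> * e)" by (simp add: thickening_def)
    moreover have "u \<in> thickening R M (\<kappa>\<Theta> * e)"
    proof -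
      have "0 \<le> \<kappa>\<Theta> * e" using \<kappa>\<Theta>_nonneg e_nonneg by simp
      then show ?thesis using distU_le_normU[OF R u, of u] by (simp add: thickening_def M_def)
    qed
    ultimately have "ennreal (normU R (u - a k))
        \<le> stab_delta R M W 0 + 2 * stab_mu R M W * ennreal (\<kappa>\<Theta> * e)"
      \<comment> \<open>The thickness is the guaranteed distance of the selected candidate to the manifold; the
        unknown itself has distance 0.\<close>
      using \<kappa>\<Theta>_nonneg e_nonneg recovery_in_observation_fiber[OF R W(1)]
      by (intro norm_diff_le_stability[OF wW] ufib) (auto simp: a_def)
    then show ?thesis
      using \<kappa>\<Theta>_nonneg e_nonneg by (simp add: good_def ennreal_mult mult_ac)
  qed

  have prob_E: "prob {\<omega> \<in> space \<Omega>. E k \<omega>} \<ge> 1 - \<delta>" for k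
    using cases
  proof (elim disjE conjE exE)
    assume "finite Q" "Q \<noteq> {}" "oblivious_embedding \<Omega> R \<Theta> \<epsilon> (\<delta> / real (card Q)) 1"
    then show ?thesis
      unfolding E_def by (rule finite_parameters_residuals_preserved[OF \<Omega> \<Theta>])
  next
    fix mB mf
    assume QP: "Q = P" and aff: "affine_parametrization P B f mB mf"
      and ob: "oblivious_embedding \<Omega> R \<Theta> \<epsilon> \<delta> (mB + mf + 1)"
    show ?thesis
      unfolding E_def QP
      by (rule oblivious_embedding_prob_of_dim_le[OF \<Omega> \<Theta> ob affine_residuals_dim_le[OF aff]])
  qed
  have "{\<omega> \<in> space \<Omega>. E k \<omega>} \<in> events" for k
    unfolding E_def by (rule sets_subspace_embedding[OF \<Theta>])
  from prob_ball_ge[OF finite_atLeastAtMost[of 1 N] this prob_E]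
  have "1 - real N * \<delta> \<le> prob {\<omega> \<in> space \<Omega>. \<forall>k\<in>{1..N}. E k \<omega>}" by simp
  also have "\<dots> \<le> prob {\<omega> \<in> space \<Omega>. \<forall>k\<in>{1..N}. sel \<omega> k \<longrightarrow> good k}"
  proof (rule finite_measure_mono)
    have [measurable]: "(\<lambda>\<omega>. sketch_res_dist R (\<Theta> \<omega>) B f v Q) \<in> borel_measurable \<Omega>" for v
      by (rule borel_measurable_sketch_res_dist[OF \<Theta> Q])
    show "{\<omega> \<in> space \<Omega>. \<forall>k\<in>{1..N}. sel \<omega> k \<longrightarrow> good k} \<in> events"
      unfolding sel_def by measurable
  next
    show "{\<omega> \<in> space \<Omega>. \<forall>k\<in>{1..N}. E k \<omega>}
        \<subseteq> {\<omega> \<in> space \<Omega>. \<forall>k\<in>{1..N}. sel \<omega> k \<longrightarrow> good k}"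
      by (intro Collect_mono impI conjI ballI) (auto intro: selected_good)
  qed
  also have "{\<omega> \<in> space \<Omega>. \<forall>k\<in>{1..N}. sel \<omega> k \<longrightarrow> good k} = {\<omega> \<in> space \<Omega>.
      \<forall>x \<in> multi_recovery R W V N (\<lambda>v. sketch_res_dist R (\<Theta> \<omega>) B f v Q) w.
        ennreal (normU R (u - x)) \<le> stab_delta R M W 0 + ennreal (2 * \<kappa>\<Theta>) * stab_mu R M W * ennreal e}"
  proof -
    have "is_arg_min (\<lambda>j. sketch_res_dist R (\<Theta> \<omega>) B f (a j) Q) (\<lambda>j. j \<in> {1..N}) k
        \<longleftrightarrow> k \<in> {1..N} \<and> sel \<omega> k" for \<omega> k
      unfolding is_arg_min_def sel_def by blast
    then have "multi_recovery R W V N (\<lambda>v. sketch_res_dist R (\<Theta> \<omega>) B f v Q) w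
        = a ` {k \<in> {1..N}. sel \<omega> k}" for \<omega>
      unfolding multi_recovery_def a_def[symmetric] by blast
    then show ?thesis by (auto simp: good_def)
  qed
  finally show ?thesis unfolding M_def e_def a_def .
qed

end
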